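(* Let $\Gamma$ be a finitely generated solvable group which is not polycyclic. Then $\Gamma$ contains a subgroup which is a properly ascending HNN extension.
   Context: A properly ascending HNN extension with base $B$ is a group of the form $\langle B, t \mid t B t^{-1} \subset B\rangle$ with $tBt^{-1} \neq B$. That is, it is the HNN extension of a group $B$ with associated subgroups $H_1 = B$ and $H_2 = \varphi(B)$, where $\varphi : B \to B$ is an injective, non-surjective homomorphism. It is generated by $B$ together with a stable letter $t$ of infinite order, subject to the relations of $B$ and $t b t^{-1} = \varphi(b)$ for all $b \in B$. The base $B$ need not be finitely generated. A group is said to be a properly ascending HNN extension if it is isomorphic to a group of this form for some $B$ and $\varphi$. *)

theory Defs
  imports "HOL-Algebra.Algebra"
begin

section \<open>Finitely generated and polycyclic groups\<close>

definition finitely_generated_group :: "('a, 'm) monoid_scheme \<Rightarrow> bool" where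
  "finitely_generated_group G \<longleftrightarrow>
     group G \<and> (\<exists>S. finite S \<and> S \<subseteq> carrier G \<and> generate G S = carrier G)"

text \<open>Finite subnormal series with (finite or infinite) cyclic factors. Only the sets
  \<open>F 0, \<dots>, F n\<close> matter; normality of \<open>F i\<close> in \<open>F (Suc i)\<close> includes
  that \<open>F (Suc i)\<close> is a group under the operations of \<open>G\<close>.\<close>

definition polycyclic_group :: "('a, 'm) monoid_scheme \<Rightarrow> bool" where
  "polycyclic_group G \<longleftrightarrow> group G \<and>
     (\<exists>(n :: nat) F. F 0 = {\<one>\<^bsub>G\<^esub>} \<and> F n = carrier G \<and>
        (\<forall>i<n. F i \<lhd> (G\<lparr>carrier := F (Suc i)\<rparr>) \<and>
               cyclic_group ((G\<lparr>carrier := F (Suc i)\<rparr>) Mod F i)))"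


section \<open>HNN extensions\<close>

text \<open>The HNN extension of \<open>B\<close> along \<open>\<phi> : A \<rightarrow> B\<close> is the group with presentation
  \<open>\<langle> B, t | t a t\<^sup>-\<^sup>1 = \<phi> a for a \<in> A \<rangle>\<close>. It is realised as the monoid of words in the
  elements of \<open>B\<close> and the two letters \<open>t\<close> and \<open>t\<^sup>-\<^sup>1\<close>, modulo the least congruence
  containing the multiplication table of \<open>B\<close>, the cancellation of \<open>t\<close> against
  \<open>t\<^sup>-\<^sup>1\<close>, and the conjugation relations.\<close>

datatype 'b hnn_letter = Base 'b | Stable | Stable_inv

definition hnn_words :: "('b, 'm) monoid_scheme \<Rightarrow> 'b hnn_letter list set" where
  "hnn_words B = lists (Base ` carrier B \<union> {Stable, Stable_inv})"

inductive hnn_eq ::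
  "('b, 'm) monoid_scheme \<Rightarrow> 'b set \<Rightarrow> ('b \<Rightarrow> 'b) \<Rightarrow> 'b hnn_letter list \<Rightarrow> 'b hnn_letter list \<Rightarrow> bool"
  for B and A and \<phi> where
  base_mult: "\<lbrakk>x \<in> carrier B; y \<in> carrier B\<rbrakk>
      \<Longrightarrow> hnn_eq B A \<phi> [Base x, Base y] [Base (x \<otimes>\<^bsub>B\<^esub> y)]"
| base_one: "hnn_eq B A \<phi> [Base \<one>\<^bsub>B\<^esub>] []"
| stable_right_inv: "hnn_eq B A \<phi> [Stable, Stable_inv] []"
| stable_left_inv: "hnn_eq B A \<phi> [Stable_inv, Stable] []"
| stable_conj: "a \<in> A \<Longrightarrow> hnn_eq B A \<phi> [Stable, Base a, Stable_inv] [Base (\<phi> a)]"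
| refl: "w \<in> hnn_words B \<Longrightarrow> hnn_eq B A \<phi> w w"
| sym: "hnn_eq B A \<phi> u v \<Longrightarrow> hnn_eq B A \<phi> v u"
| trans: "\<lbrakk>hnn_eq B A \<phi> u v; hnn_eq B A \<phi> v w\<rbrakk> \<Longrightarrow> hnn_eq B A \<phi> u w"
| append: "\<lbrakk>hnn_eq B A \<phi> u u'; hnn_eq B A \<phi> v v'\<rbrakk> \<Longrightarrow> hnn_eq B A \<phi> (u @ v) (u' @ v')"

definition hnn_rel ::
  "('b, 'm) monoid_scheme \<Rightarrow> 'b set \<Rightarrow> ('b \<Rightarrow> 'b) \<Rightarrow> 'b hnn_letter list rel" where
  "hnn_rel B A \<phi> = {(u, v). hnn_eq B A \<phi> u v}"

definition hnn_extension ::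
  "('b, 'm) monoid_scheme \<Rightarrow> 'b set \<Rightarrow> ('b \<Rightarrow> 'b) \<Rightarrow> 'b hnn_letter list set monoid" where
  "hnn_extension B A \<phi> =
    \<lparr>carrier = hnn_words B // hnn_rel B A \<phi>,
     monoid.mult = (\<lambda>P Q. \<Union>u\<in>P. \<Union>v\<in>Q. hnn_rel B A \<phi> `` {u @ v}),
     monoid.one = hnn_rel B A \<phi> `` {[]}\<rparr>"

lemma hnn_eq_words:
  assumes "group B" "subgroup A B" "\<phi> \<in> hom (B\<lparr>carrier := A\<rparr>) B" "hnn_eq B A \<phi> u v"
  shows "u \<in> hnn_words B \<and> v \<in> hnn_words B"
proof -
  interpret B: group B by fact
  have A: "a \<in> carrier B" if "a \<in> A" for a
    using that subgroup.subset[OF assms(2)] by blast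
  have \<phi>: "\<phi> a \<in> carrier B" if "a \<in> A" for a
    using assms(3) that by (auto simp: hom_def)
  show ?thesis
    using assms(4) by induction (auto simp: hnn_words_def A \<phi>)
qed

lemma equiv_hnn_rel:
  assumes "group B" "subgroup A B" "\<phi> \<in> hom (B\<lparr>carrier := A\<rparr>) B"
  shows "equiv (hnn_words B) (hnn_rel B A \<phi>)"
proof (rule equivI)
  show "hnn_rel B A \<phi> \<subseteq> hnn_words B \<times> hnn_words B"
    using hnn_eq_words[OF assms] by (auto simp: hnn_rel_def)
  show "refl_on (hnn_words B) (hnn_rel B A \<phi>)"
    by (auto simp: hnn_rel_def refl_on_def intro: hnn_eq.refl)
  show "Relation.sym (hnn_rel B A \<phi>)"
    by (auto simp: hnn_rel_def sym_def intro: hnn_eq.sym)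
  show "Relation.trans (hnn_rel B A \<phi>)"
    by (auto simp: hnn_rel_def trans_def intro: hnn_eq.trans)
qed

lemma hnn_mult_class:
  assumes "group B" "subgroup A B" "\<phi> \<in> hom (B\<lparr>carrier := A\<rparr>) B"
    and "u \<in> hnn_words B" "v \<in> hnn_words B"
  shows "(hnn_rel B A \<phi> `` {u}) \<otimes>\<^bsub>hnn_extension B A \<phi>\<^esub> (hnn_rel B A \<phi> `` {v})
       = hnn_rel B A \<phi> `` {u @ v}"
proof -
  have "hnn_rel B A \<phi> `` {u' @ v'} = hnn_rel B A \<phi> `` {u @ v}"
    if "u' \<in> hnn_rel B A \<phi> `` {u}" "v' \<in> hnn_rel B A \<phi> `` {v}" for u' v'
    using that
    by (intro equiv_class_eq[OF equiv_hnn_rel[OF assms(1-3)]])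
       (auto simp: hnn_rel_def intro: hnn_eq.append hnn_eq.sym)
  moreover have "u \<in> hnn_rel B A \<phi> `` {u}" "v \<in> hnn_rel B A \<phi> `` {v}"
    using assms(4,5) by (auto simp: hnn_rel_def intro: hnn_eq.refl)
  ultimately have "(\<Union>u'\<in>hnn_rel B A \<phi> `` {u}. \<Union>v'\<in>hnn_rel B A \<phi> `` {v}. hnn_rel B A \<phi> `` {u' @ v'})
      = hnn_rel B A \<phi> `` {u @ v}"
    by blast
  then show ?thesis
    by (simp only: hnn_extension_def monoid.select_convs)
qed

lemma hnn_left_inverse:
  assumes "group B" "w \<in> hnn_words B"
  shows "\<exists>w' \<in> hnn_words B. hnn_eq B A \<phi> (w' @ w) []"
  using assms(2)
proof (induction w)
  case Nil
  show ?case by (rule bexI[of _ "[]"]) (auto simp: hnn_words_def intro: hnn_eq.refl)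
next
  case (Cons l w)
  interpret B: group B by fact
  have w: "w \<in> hnn_words B" and l: "l \<in> Base ` carrier B \<union> {Stable, Stable_inv}"
    using Cons.prems by (auto simp: hnn_words_def)
  obtain w' where w': "w' \<in> hnn_words B" "hnn_eq B A \<phi> (w' @ w) []"
    using Cons.IH w by blast
  have "\<exists>l'. [l'] \<in> hnn_words B \<and> hnn_eq B A \<phi> [l', l] []"
  proof -
    consider x where "x \<in> carrier B" "l = Base x" | "l = Stable" | "l = Stable_inv"
      using l by blast
    then show ?thesis
    proof cases
      case (1 x)
      then have "hnn_eq B A \<phi> [Base (inv\<^bsub>B\<^esub> x), Base x] [Base \<one>\<^bsub>B\<^esub>]"
        using hnn_eq.base_mult[of "inv\<^bsub>B\<^esub> x" B x] by simp
      then show ?thesis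
        using 1 by (intro exI[of _ "Base (inv\<^bsub>B\<^esub> x)"])
          (auto simp: hnn_words_def intro: hnn_eq.trans hnn_eq.base_one)
    next
      case 2
      then show ?thesis
        by (intro exI[of _ Stable_inv]) (auto simp: hnn_words_def intro: hnn_eq.stable_left_inv)
    next
      case 3
      then show ?thesis
        by (intro exI[of _ Stable]) (auto simp: hnn_words_def intro: hnn_eq.stable_right_inv)
    qed
  qed
  then obtain l' where l': "[l'] \<in> hnn_words B" "hnn_eq B A \<phi> [l', l] []" by blast
  have "hnn_eq B A \<phi> (w' @ ([l', l] @ w)) (w' @ ([] @ w))"
    using w w' l' by (intro hnn_eq.append hnn_eq.refl)
  then have "hnn_eq B A \<phi> ((w' @ [l']) @ (l # w)) []"
    using w'(2) by (auto intro: hnn_eq.trans)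
  moreover have "w' @ [l'] \<in> hnn_words B"
    using w' l' by (auto simp: hnn_words_def)
  ultimately show ?case by blast
qed

lemma group_hnn_extension:
  assumes "group B" "subgroup A B" "\<phi> \<in> hom (B\<lparr>carrier := A\<rparr>) B"
  shows "group (hnn_extension B A \<phi>)"
proof -
  let ?G = "hnn_extension B A \<phi>" and ?c = "\<lambda>w. hnn_rel B A \<phi> `` {w}"
  note mult = hnn_mult_class[OF assms]
  have carr: "carrier ?G = ?c ` hnn_words B"
    by (auto simp: hnn_extension_def quotient_def)
  have one: "\<one>\<^bsub>?G\<^esub> = ?c []" by (simp add: hnn_extension_def)
  have app: "u @ v \<in> hnn_words B" if "u \<in> hnn_words B" "v \<in> hnn_words B" for u v
    using that by (simp add: hnn_words_def)
  have nil: "[] \<in> hnn_words B" by (simp add: hnn_words_def)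
  show ?thesis
  proof (rule groupI)
    fix P assume "P \<in> carrier ?G"
    then obtain w where w: "w \<in> hnn_words B" "P = ?c w" by (auto simp: carr)
    obtain w' where w': "w' \<in> hnn_words B" "hnn_eq B A \<phi> (w' @ w) []"
      using hnn_left_inverse[OF assms(1) w(1)] by blast
    have "?c (w' @ w) = ?c []"
      using w'(2) by (intro equiv_class_eq[OF equiv_hnn_rel[OF assms]]) (simp add: hnn_rel_def)
    then have "?c w' \<otimes>\<^bsub>?G\<^esub> P = \<one>\<^bsub>?G\<^esub>" using w w' by (simp add: mult one)
    then show "\<exists>Q \<in> carrier ?G. Q \<otimes>\<^bsub>?G\<^esub> P = \<one>\<^bsub>?G\<^esub>" using w' by (auto simp: carr)
  qed (auto simp: carr one mult app nil)
qed


section \<open>Properly ascending HNN extensions\<close>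

text \<open>Taking the elements of the base from the type of the elements of \<open>G\<close> is no restriction,
  since the base of an HNN extension embeds into it.\<close>

definition properly_ascending_hnn :: "('a, 'm) monoid_scheme \<Rightarrow> bool" where
  "properly_ascending_hnn G \<longleftrightarrow> group G \<and>
     (\<exists>(B :: 'a monoid) \<phi>. group B \<and> \<phi> \<in> mon B B \<and> \<phi> ` carrier B \<noteq> carrier B \<and>
        G \<cong> hnn_extension B (carrier B) \<phi>)"

end

theory Submission
  imports Defs
begin

text \<open>Suppose that \<open>t B t\<^sup>-\<^sup>1 \<subset> B\<close> properly for some subgroup \<open>B\<close> and some element \<open>t\<close>. Then no
  nontrivial power of \<open>t\<close> lies in \<open>B\<close>, so the expressions \<open>t\<^sup>-\<^sup>p b t\<^sup>q\<close>, to which every word of the HNN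
  extension reduces, are trivial in \<open>\<langle>B, t\<rangle>\<close> only if they are trivial in the HNN extension. Hence
  \<open>\<langle>B, t\<rangle>\<close> is the ascending HNN extension of \<open>B\<close> along conjugation by \<open>t\<close>.

  Suppose that there are no such \<open>B\<close> and \<open>t\<close>, and let \<open>M\<close> be finitely generated with \<open>M / L\<close> cyclic,
  generated by the class of \<open>x\<close>. For a suitable finite \<open>A \<subseteq> L\<close>, the subgroup generated by
  \<open>x\<^sup>i A x\<^sup>-\<^sup>i\<close>, \<open>i \<ge> 0\<close>, is mapped into itself by \<open>x\<close>, hence normalised by \<open>x\<close>, hence equal to \<open>L\<close>.
  So \<open>x\<^sup>-\<^sup>1 A x\<close> lies in the subgroup generated by \<open>x\<^sup>i A x\<^sup>-\<^sup>i\<close>, \<open>0 \<le> i \<le> m\<close>, for some \<open>m\<close>. This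
  subgroup is mapped into itself by \<open>x\<^sup>-\<^sup>1\<close>, hence normalised by \<open>x\<close>, hence equal to \<open>L\<close>. Thus \<open>L\<close> is
  finitely generated, and descending along a solvable series refined by cyclic steps shows that the
  group is polycyclic.\<close>

section \<open>Conjugation\<close>

definition conjugate :: "('a, 'm) monoid_scheme \<Rightarrow> 'a \<Rightarrow> 'a \<Rightarrow> 'a" where
  "conjugate G g x = g \<otimes>\<^bsub>G\<^esub> x \<otimes>\<^bsub>G\<^esub> inv\<^bsub>G\<^esub> g"

text \<open>Its failure for all \<open>t\<close> and \<open>B\<close> is the hypothesis
  \<open>nc\<close> of the polycyclicity argument; one instance of it is the assumption of the
  locale \<open>strict_contraction\<close>.\<close>

definition strictly_contracts :: "('a, 'm) monoid_scheme \<Rightarrow> 'a \<Rightarrow> 'a set \<Rightarrow> bool" where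
  "strictly_contracts G t B \<longleftrightarrow>
     t \<in> carrier G \<and> subgroup B G \<and> conjugate G t ` B \<subset> B"

context group
begin

lemma inv_mult_cancel [simp]:
  assumes "g \<in> carrier G" "y \<in> carrier G"
  shows "inv g \<otimes> (g \<otimes> y) = y" "g \<otimes> (inv g \<otimes> y) = y"
  using assms by (simp_all flip: m_assoc)

lemma conjugate_closed [simp]:
  "\<lbrakk>g \<in> carrier G; x \<in> carrier G\<rbrakk> \<Longrightarrow> conjugate G g x \<in> carrier G"
  by (simp add: conjugate_def)

lemma conjugate_group_hom: "g \<in> carrier G \<Longrightarrow> group_hom G G (conjugate G g)"
  by unfold_locales (simp add: hom_def conjugate_def m_assoc)

lemma conjugate_mult:
  "\<lbrakk>g \<in> carrier G; x \<in> carrier G; y \<in> carrier G\<rbrakk> \<Longrightarrow>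
    conjugate G g (x \<otimes> y) = conjugate G g x \<otimes> conjugate G g y"
  using group_hom.hom_mult[OF conjugate_group_hom] .

lemma conjugate_conjugate:
  "\<lbrakk>g \<in> carrier G; h \<in> carrier G; x \<in> carrier G\<rbrakk> \<Longrightarrow>
    conjugate G g (conjugate G h x) = conjugate G (g \<otimes> h) x"
  by (simp add: conjugate_def m_assoc inv_mult_group)

lemma conjugate_one [simp]: "x \<in> carrier G \<Longrightarrow> conjugate G \<one> x = x"
  by (simp add: conjugate_def)

lemma conjugate_pow_Suc:
  assumes "g \<in> carrier G" "x \<in> carrier G"
  shows "conjugate G (g [^] Suc n) x = conjugate G g (conjugate G (g [^] n) x)"
  using assms by (subst nat_pow_Suc2) (simp_all add: conjugate_conjugate)

lemma inj_on_conjugate: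
  assumes "g \<in> carrier G" shows "inj_on (conjugate G g) (carrier G)"
  by (rule inj_on_inverseI[of _ "conjugate G (inv g)"]) (simp add: assms conjugate_conjugate)

lemma conjugate_inv_image_subset:
  assumes "g \<in> carrier G" "B \<subseteq> carrier G" "conjugate G g ` B = B"
  shows "conjugate G (inv g) ` B \<subseteq> B"
proof -
  have "conjugate G (inv g) (conjugate G g x) = x" if "x \<in> B" for x
    using that assms by (auto simp: conjugate_conjugate)
  then show ?thesis
    using assms(3) by (metis image_subsetI imageE)
qed

lemma conjugate_int_pow_closed:
  fixes k :: int
  assumes "x \<in> carrier G" "L \<subseteq> carrier G"
    and "conjugate G x ` L \<subseteq> L" "conjugate G (inv x) ` L \<subseteq> L" "l \<in> L"
  shows "conjugate G (x [^] k) l \<in> L"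
proof -
  have l: "l \<in> carrier G" using assms by blast
  have nat: "conjugate G (y [^] n) l \<in> L"
    if y: "y \<in> carrier G" "conjugate G y ` L \<subseteq> L" for y and n :: nat
  proof (induction n)
    case 0
    then show ?case using l assms(5) by simp
  next
    case (Suc n)
    then show ?case unfolding conjugate_pow_Suc[OF y(1) l] by (rule subsetD[OF y(2) imageI])
  qed
  show ?thesis
  proof (cases k rule: int_cases)
    case (nonneg n)
    show ?thesis unfolding nonneg int_pow_int by (rule nat[OF assms(1,3)])
  next
    case (neg n)
    have "x [^] k = inv x [^] Suc n"
      unfolding neg int_pow_neg_int[OF assms(1)] nat_pow_inv[OF assms(1)] by simp
    then show ?thesis using nat[OF _ assms(4), of "Suc n"] assms(1) by (simp del: nat_pow_Suc)
  qed
qed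

text \<open>A power of \<open>x\<close> moves to the right past an element of \<open>L\<close> by
  conjugating it, which stays inside \<open>L\<close>. Invariance is assumed in both directions
  because the exponents are integers.\<close>

lemma generate_insert_normalized:
  assumes L: "subgroup L G" and x: "x \<in> carrier G"
    and conj: "conjugate G x ` L \<subseteq> L" "conjugate G (inv x) ` L \<subseteq> L"
    and e: "e \<in> generate G (insert x L)"
  shows "\<exists>l\<in>L. \<exists>k::int. e = l \<otimes> x [^] k"
proof -
  interpret L: subgroup L G by fact
  have conjk: "conjugate G (x [^] k) l \<in> L" if "l \<in> L" for l and k :: int
    using conjugate_int_pow_closed[OF x L.subset conj that] .
  show ?thesis
    using e
  proof induction
    case one
    show ?case by (rule bexI[of _ "\<one>"], rule exI[of _ 0]) auto
  next
    case (incl h)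
    show ?case
    proof (cases "h = x")
      case True
      then show ?thesis using x by (intro bexI[of _ "\<one>"] exI[of _ 1]) auto
    next
      case False
      then show ?thesis using incl by (intro bexI[of _ h] exI[of _ 0]) auto
    qed
  next
    case (inv h)
    show ?case
    proof (cases "h = x")
      case True
      then show ?thesis using x by (intro bexI[of _ "\<one>"] exI[of _ "-1"]) (auto simp: int_pow_neg)
    next
      case False
      then show ?thesis using inv by (intro bexI[of _ "inv h"] exI[of _ 0]) auto
    qed
  next
    case (eng h1 h2)
    obtain l1 k1 where 1: "l1 \<in> L" "h1 = l1 \<otimes> x [^] (k1::int)" using eng by blast
    obtain l2 k2 where 2: "l2 \<in> L" "h2 = l2 \<otimes> x [^] (k2::int)" using eng by blast
    have "h1 \<otimes> h2 = l1 \<otimes> conjugate G (x [^] k1) l2 \<otimes> x [^] (k1 + k2)"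
      using 1 2 x by (simp add: conjugate_def int_pow_mult m_assoc)
    then show ?case using conjk[OF 2(1)] 1 by blast
  qed
qed

end

text \<open>Division with remainder by the least positive element; \<open>d = 0\<close> covers the
  trivial subgroup. It will be applied to the exponents \<open>k\<close> with \<open>x [^] k\<close>
  in a given subgroup.\<close>

lemma int_subgroup_principal:
  fixes I :: "int set"
  assumes 0: "0 \<in> I" and diff: "\<And>a b. \<lbrakk>a \<in> I; b \<in> I\<rbrakk> \<Longrightarrow> a - b \<in> I"
  shows "\<exists>d\<in>I. \<forall>k\<in>I. d dvd k"
proof (cases "I \<subseteq> {0}")
  case False
  have neg: "- a \<in> I" if "a \<in> I" for a using diff[OF 0 that] by simp
  have add: "a + b \<in> I" if "a \<in> I" "b \<in> I" for a b using diff[OF that(1) neg[OF that(2)]] by simp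
  define P where "P n \<longleftrightarrow> n > 0 \<and> int n \<in> I" for n
  obtain a where "a \<in> I" "a \<noteq> 0" using False by blast
  then have "P (nat \<bar>a\<bar>)" using neg by (auto simp: P_def abs_if)
  define d where "d = (LEAST n. P n)"
  have d: "d > 0" "int d \<in> I"
    using LeastI[of P, OF \<open>P (nat \<bar>a\<bar>)\<close>] by (simp_all add: d_def P_def)
  have mult: "int n * int d \<in> I" for n
    by (induction n) (use 0 add d in \<open>auto simp: algebra_simps\<close>)
  have multi: "z * int d \<in> I" for z
    using mult[of "nat z"] neg[OF mult[of "nat (- z)"]] by (cases "z \<ge> 0") auto
  have "int d dvd k" if "k \<in> I" for k
  proof -
    define r where "r = k mod int d"
    have "r \<in> I"
      unfolding r_def minus_div_mult_eq_mod[symmetric] by (rule diff[OF that multi])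
    moreover have r: "0 \<le> r" "r < int d"
      using d(1) by (simp_all only: r_def pos_mod_sign pos_mod_bound of_nat_0_less_iff)
    moreover have "\<not> P (nat r)"
      using r unfolding d_def by (intro not_less_Least) linarith
    ultimately have "k mod int d = 0" by (simp add: P_def flip: r_def)
    then show ?thesis by (rule dvd_eq_mod_eq_0[THEN iffD2])
  qed
  then show ?thesis using d(2) by (intro bexI[of _ "int d"] ballI)
next
  case True
  then have "0 dvd k" if "k \<in> I" for k using that by blast
  then show ?thesis using 0 by (intro bexI[of _ 0] ballI)
qed


section \<open>Kernels of maps onto cyclic groups\<close>

context group
begin

text \<open>An inclusion of \<open>t B t^-1\<close> in \<open>B\<close> that cannot be strict is an
  equality, and conjugation by \<open>inv t\<close> undoes it. The hypothesis \<open>nc\<close> acts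
  only through this lemma.\<close>

lemma conjugate_inv_subset:
  assumes "\<And>t B. \<not> strictly_contracts G t B"
    and "t \<in> carrier G" "subgroup B G" "conjugate G t ` B \<subseteq> B"
  shows "conjugate G (inv t) ` B \<subseteq> B"
proof -
  have *: "conjugate G t ` B = B"
    using assms unfolding strictly_contracts_def by blast
  show "conjugate G (inv t) ` B \<subseteq> B"
    using conjugate_inv_image_subset[OF assms(2) subgroup.subset[OF assms(3)] *] .
qed

lemma conjugate_generate_subset:
  assumes "t \<in> carrier G" "A \<subseteq> carrier G" "conjugate G t ` A \<subseteq> generate G A"
  shows "conjugate G t ` generate G A \<subseteq> generate G A"
  using group_hom.generate_img[OF conjugate_group_hom[OF assms(1)] assms(2)]
    generate_subgroup_incl[OF assms(3) generate_is_subgroup[OF assms(2)]] by simp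

text \<open>Two factors lie in a common member of an ascending chain, so the union of the chain is
  closed under products.\<close>

lemma generate_mono_Union:
  fixes C :: "nat \<Rightarrow> 'a set"
  assumes C: "\<And>m. subgroup (C m) G" "mono C"
    and "A \<subseteq> (\<Union>m. C m)" "e \<in> generate G A"
  shows "\<exists>m. e \<in> C m"
  using assms(4)
proof induction
  case one
  then show ?case using subgroup.one_closed[OF C(1)] by blast
next
  case (incl h)
  then show ?case using assms(3) by blast
next
  case (inv h)
  then show ?case using assms(3) subgroup.m_inv_closed[OF C(1)] by blast
next
  case (eng h1 h2)
  then obtain m n where "h1 \<in> C m" "h2 \<in> C n" by blast
  then have "h1 \<in> C (max m n)" "h2 \<in> C (max m n)"
    using monoD[OF C(2), of m "max m n"] monoD[OF C(2), of n "max m n"] by auto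
  then show ?case using subgroup.m_closed[OF C(1)] by blast
qed

text \<open>By \<open>conj\<close>, \<open>x\<close> normalises \<open>L\<close>, so
  \<open>L\<close> is the kernel of a map from the subgroup generated by \<open>x\<close> and
  \<open>L\<close> onto a cyclic group. The absence of strict contractions is used twice, for
  \<open>x\<close> and then for \<open>inv x\<close>.\<close>

lemma finitely_generated_cyclic_kernel:
  assumes nc: "\<And>t B. \<not> strictly_contracts G t B"
    and L: "subgroup L G" and x: "x \<in> carrier G"
    and conj: "conjugate G x ` L \<subseteq> L" "conjugate G (inv x) ` L \<subseteq> L"
    and T: "finite T" "generate G T = generate G (insert x L)" "T \<subseteq> carrier G"
  shows "\<exists>A. finite A \<and> A \<subseteq> L \<and> generate G A = L"
proof -
  interpret L: subgroup L G by fact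
  \<comment> \<open>Each generator splits into an \<open>L\<close>-part and a power of
    \<open>x\<close>; the \<open>L\<close>-parts go into \<open>A\<close>.\<close>
  have "\<forall>s\<in>T. \<exists>l\<in>L. \<exists>k::int. s = l \<otimes> x [^] k"
    using generate_insert_normalized[OF L x conj] T(2) generate.incl by metis
  then obtain l where l: "\<And>s. s \<in> T \<Longrightarrow> l s \<in> L" "\<And>s. s \<in> T \<Longrightarrow> \<exists>k::int. s = l s \<otimes> x [^] k"
    by metis
  obtain d :: int where d: "x [^] d \<in> L" "\<And>k. x [^] k \<in> L \<Longrightarrow> d dvd k"
    using int_subgroup_principal[of "{k. x [^] k \<in> L}"] x by (auto simp: int_pow_diff)
  \<comment> \<open>\<open>x\<^sup>d\<close> is needed when \<open>x\<close> has finite order modulo \<open>L\<close>; otherwise \<open>d = 0\<close>.\<close>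
  define A where "A = insert (x [^] d) (l ` T)"
  have A: "finite A" "A \<subseteq> L" "A \<subseteq> carrier G" using T(1) l d L.subset by (auto simp: A_def)
  define W where "W m = {conjugate G (x [^] i) a |i a. i \<le> m \<and> a \<in> A}" for m :: nat
  define C where "C m = generate G (W m)" for m
  have W: "W m \<subseteq> carrier G" "finite (W m)" "W m \<subseteq> L" for m
  proof -
    show "W m \<subseteq> carrier G" using A x by (auto simp: W_def)
    have "W m = (\<lambda>(i, a). conjugate G (x [^] i) a) ` ({..m} \<times> A)" by (auto simp: W_def)
    then show "finite (W m)" using A by simp
    show "W m \<subseteq> L"
      using A conjugate_int_pow_closed[OF x L.subset conj, of _ "int _"]
      by (auto simp: W_def int_pow_int)
  qed
  have C: "subgroup (C m) G" "C m \<subseteq> L" for m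
    using generate_is_subgroup[OF W(1)] generate_subgroup_incl[OF W(3) L] by (auto simp: C_def)
  have AW: "A \<subseteq> W 0" using A by (force simp: W_def)
  have WM: "mono W" by (force simp: mono_def W_def)
  then have CM: "mono C" unfolding mono_def C_def by (blast intro: mono_generate[THEN subsetD])
  define D where "D = generate G (\<Union>m. W m)"
  have D: "subgroup D G" "D \<subseteq> L"
    using generate_is_subgroup[of "\<Union>m. W m"] generate_subgroup_incl[of "\<Union>m. W m" L] W(1,3) L
    unfolding D_def by blast+
  \<comment> \<open>Conjugation by \<open>x\<close> moves each stage into the next, so it maps
    \<open>D\<close>, generated by all the stages, into itself.\<close>
  have shift: "conjugate G x w \<in> W (Suc m)" if w: "w \<in> W m" for w m
  proof -
    obtain i a where "i \<le> m" "a \<in> A" "w = conjugate G (x [^] i) a"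
      using w by (auto simp: W_def)
    moreover from this have "conjugate G x w = conjugate G (x [^] Suc i) a"
      using A x by (subst conjugate_pow_Suc) auto
    ultimately show ?thesis unfolding W_def by (blast intro: Suc_le_mono[THEN iffD2])
  qed
  have "conjugate G x ` D \<subseteq> D"
    unfolding D_def
  proof (intro conjugate_generate_subset x)
    show "(\<Union>m. W m) \<subseteq> carrier G" using W(1) by blast
    show "conjugate G x ` (\<Union>m. W m) \<subseteq> generate G (\<Union>m. W m)"
      using shift by (blast intro: generate.incl)
  qed
  note Dx = this conjugate_inv_subset[OF nc x D(1) this]
  have AD: "A \<subseteq> D" using AW unfolding D_def by (blast intro: generate.incl)
  \<comment> \<open>\<open>D\<close> and \<open>x\<close> generate all of \<open>T\<close>, so an
    element \<open>e\<close> of \<open>L\<close> is \<open>b\<close> times a power of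
    \<open>x\<close> with \<open>b\<close> in \<open>D\<close>. That power lies in \<open>L\<close>,
    hence is a power of \<open>x [^] d\<close>, which belongs to \<open>A\<close>.\<close>
  have "L \<subseteq> D"
  proof
    fix e assume e: "e \<in> L"
    have "T \<subseteq> generate G (insert x D)"
    proof
      fix s assume s: "s \<in> T"
      obtain k :: int where k: "s = l s \<otimes> x [^] k" using l s by blast
      have sub: "subgroup (generate G (insert x D)) G"
        using x D subgroup.subset[OF D(1)] by (intro generate_is_subgroup) auto
      have "l s \<in> generate G (insert x D)" using AD s by (auto simp: A_def intro: generate.incl)
      moreover have "x [^] k \<in> generate G (insert x D)"
        using subgroup_int_pow_closed[OF sub] by (simp add: generate.incl)
      ultimately show "s \<in> generate G (insert x D)" using k generate.eng by metis
    qed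
    then have "generate G T \<subseteq> generate G (insert x D)"
      using x subgroup.subset[OF D(1)] by (intro generate_subgroup_incl generate_is_subgroup) auto
    then have "e \<in> generate G (insert x D)" using T(2) e by (auto intro: generate.incl)
    then obtain b k where b: "b \<in> D" "e = b \<otimes> x [^] (k::int)"
      using generate_insert_normalized[OF D(1) x Dx] by blast
    have "inv b \<otimes> e \<in> L" using b(1) e D(2) by (intro L.m_closed L.m_inv_closed) auto
    moreover have "inv b \<otimes> e = x [^] k"
      using b x subgroup.mem_carrier[OF D(1)] by (simp flip: m_assoc)
    ultimately have "x [^] k \<in> L" by simp
    then obtain j where "k = d * j" using d(2) by blast
    then have "x [^] k = (x [^] d) [^] j" using x by (simp add: int_pow_pow)
    also have "\<dots> \<in> D" using AD by (auto simp: A_def intro: subgroup_int_pow_closed[OF D(1), of "x [^] d"])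
    finally show "e \<in> D" unfolding b(2) by (rule subgroup.m_closed[OF D(1) b(1)])
  qed
  then have DL: "D = L" using D by blast
  \<comment> \<open>Since \<open>D = L\<close> is normalised by \<open>x\<close>, these conjugates
    appear at finite stages; as \<open>A\<close> is finite, one stage \<open>m\<close> contains them
    all.\<close>
  have "\<exists>m. conjugate G (inv x) a \<in> C m" if "a \<in> A" for a
  proof (rule generate_mono_Union[OF C(1) CM, of "\<Union>m. W m"])
    show "(\<Union>m. W m) \<subseteq> (\<Union>m. C m)" unfolding C_def by (blast intro: generate.incl)
    show "conjugate G (inv x) a \<in> generate G (\<Union>m. W m)"
      using that conj A DL unfolding D_def by blast
  qed
  then obtain f where f: "\<And>a. a \<in> A \<Longrightarrow> conjugate G (inv x) a \<in> C (f a)" by metis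
  define m where "m = Max (f ` A)"
  have "f a \<le> m" if "a \<in> A" for a unfolding m_def using A(1) that by simp
  then have m: "conjugate G (inv x) a \<in> C m" if "a \<in> A" for a
    using f that monoD[OF CM] by blast
  \<comment> \<open>Conjugation by \<open>inv x\<close> lowers a positive exponent by one; for
    exponent 0 the choice of \<open>m\<close> applies.\<close>
  have "conjugate G (inv x) w \<in> generate G (W m)" if "w \<in> W m" for w
  proof -
    obtain i a where ia: "i \<le> m" "a \<in> A" "w = conjugate G (x [^] i) a"
      using \<open>w \<in> W m\<close> by (auto simp: W_def)
    show ?thesis
    proof (cases i)
      case 0
      then show ?thesis using ia m A by (auto simp: C_def)
    next
      case (Suc j)
      have "a \<in> carrier G" using ia A by blast
      then have "conjugate G (inv x) (conjugate G (x [^] i) a) = conjugate G (x [^] j) a"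
        unfolding Suc using x by (subst conjugate_pow_Suc) (auto simp: conjugate_conjugate simp flip: m_assoc)
      moreover have "conjugate G (x [^] j) a \<in> W m"
        using ia(1,2) Suc unfolding W_def by (intro CollectI exI[of _ j] exI[of _ a]) simp
      ultimately show ?thesis by (simp add: ia generate.incl)
    qed
  qed
  then have "conjugate G (inv x) ` C m \<subseteq> C m"
    unfolding C_def using x W(1) by (intro conjugate_generate_subset) auto
  then have Cx: "conjugate G x ` C m \<subseteq> C m"
    using conjugate_inv_subset[OF nc, of "inv x" "C m"] x C(1) by simp
  \<comment> \<open>\<open>C m\<close> contains \<open>A\<close> and is mapped into itself by
    \<open>x\<close>, so it contains every stage and hence \<open>L\<close>.\<close>
  have "A \<subseteq> C m" using AW monoD[OF WM, of 0 m] unfolding C_def by (blast intro: generate.incl)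
  then have "conjugate G (x [^] i) a \<in> C m" if a: "a \<in> A" for i :: nat and a
  proof (induction i)
    case 0
    have "a \<in> carrier G" using a A(3) by blast
    then show ?case using 0 a by auto
  next
    case (Suc i)
    then show ?case
      using a x A(3) Cx by (subst conjugate_pow_Suc) auto
  qed
  then have "(\<Union>m. W m) \<subseteq> C m" by (auto simp: W_def)
  then have "L \<subseteq> C m" unfolding DL[symmetric] D_def by (rule generate_subgroup_incl) (rule C)
  then show ?thesis using C(2)[of m] W(2,3)[of m] unfolding C_def by blast
qed

end


section \<open>Polycyclicity of finitely generated solvable groups\<close>

context group
begin

lemma polycyclic_group_extend:
  assumes M: "subgroup M G" and L: "L \<lhd> G\<lparr>carrier := M\<rparr>"
    and "cyclic_group (G\<lparr>carrier := M\<rparr> Mod L)" and "polycyclic_group (G\<lparr>carrier := L\<rparr>)"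
  shows "polycyclic_group (G\<lparr>carrier := M\<rparr>)"
proof -
  obtain n and F :: "nat \<Rightarrow> 'a set" where F: "F 0 = {\<one>}" "F n = L"
    "\<And>i. i < n \<Longrightarrow> F i \<lhd> G\<lparr>carrier := F (Suc i)\<rparr> \<and> cyclic_group (G\<lparr>carrier := F (Suc i)\<rparr> Mod F i)"
    using assms(4) unfolding polycyclic_group_def by auto
  define F' where "F' i = (if i \<le> n then F i else M)" for i
  have "F' 0 = {\<one>}" "F' (Suc n) = M" using F by (auto simp: F'_def)
  moreover have "F' i \<lhd> G\<lparr>carrier := F' (Suc i)\<rparr> \<and> cyclic_group (G\<lparr>carrier := F' (Suc i)\<rparr> Mod F' i)"
    if "i < Suc n" for i
    using that F(2) F(3)[of i] assms(2,3) by (cases "i < n") (auto simp: F'_def less_Suc_eq)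
  ultimately show ?thesis
    using subgroup_imp_group[OF M] unfolding polycyclic_group_def
    by (auto intro!: exI[of _ "Suc n"] exI[of _ F'])
qed

lemma polycyclic_group_trivial: "polycyclic_group (G\<lparr>carrier := {\<one>}\<rparr>)"
  using subgroup_imp_group[OF triv_subgroup] unfolding polycyclic_group_def
  by (auto intro!: exI[of _ 0] exI[of _ "\<lambda>_. {\<one>}"])

text \<open>An element of the larger group is some \<open>l\<close> in \<open>L\<close> times a
  power of \<open>x\<close>, and its coset absorbs \<open>l\<close>, so the coset of
  \<open>x\<close> generates the quotient.\<close>

lemma normal_cyclic_quotient:
  assumes L: "subgroup L G" and x: "x \<in> carrier G"
    and conj: "\<And>g. g \<in> generate G (insert x L) \<Longrightarrow> conjugate G g ` L \<subseteq> L"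
  shows "L \<lhd> G\<lparr>carrier := generate G (insert x L)\<rparr>"
    and "cyclic_group (G\<lparr>carrier := generate G (insert x L)\<rparr> Mod L)"
proof -
  let ?M = "generate G (insert x L)" and ?GM = "G\<lparr>carrier := generate G (insert x L)\<rparr>"
  have sub: "insert x L \<subseteq> carrier G" using x subgroup.subset[OF L] by blast
  have M: "subgroup ?M G" by (rule generate_is_subgroup[OF sub])
  interpret M: group ?GM by (rule subgroup_imp_group[OF M])
  have xM: "x \<in> ?M" by (simp add: generate.incl)
  have LM: "subgroup L ?GM"
    by (rule subgroup_incl[OF L M]) (auto intro: generate.incl)
  show N: "L \<lhd> ?GM"
  proof (rule M.normal_invI[OF LM])
    fix g l assume "g \<in> carrier ?GM" "l \<in> L"
    then show "g \<otimes>\<^bsub>?GM\<^esub> l \<otimes>\<^bsub>?GM\<^esub> inv\<^bsub>?GM\<^esub> g \<in> L"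
      using conj[of g] m_inv_consistent[OF M] by (auto simp: conjugate_def)
  qed
  interpret N: normal L ?GM by (rule N)
  interpret Q: group "?GM Mod L" by (rule N.factorgroup_is_group)
  have "\<exists>k::int. Y = (L #>\<^bsub>?GM\<^esub> x) [^]\<^bsub>?GM Mod L\<^esub> k" if Y: "Y \<in> carrier (?GM Mod L)" for Y
  proof -
    obtain e where e: "e \<in> ?M" "Y = L #>\<^bsub>?GM\<^esub> e" using Y by (auto simp: carrier_FactGroup)
    obtain l k where lk: "l \<in> L" "e = l \<otimes> x [^] (k::int)"
      using generate_insert_normalized[OF L x conj conj, OF xM _ e(1)]
        generate_m_inv_closed[OF sub xM] by blast
    have "l \<in> carrier G" using lk L subgroup.mem_carrier by fast
    moreover have "L #> l = L" using lk(1) L by (intro coset_join2) (auto simp: \<open>l \<in> carrier G\<close>)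
    ultimately have "L #> e = L #> x [^] k"
      using x subgroup.subset[OF L] unfolding lk by (simp flip: coset_mult_assoc)
    moreover have "(L #>\<^bsub>?GM\<^esub> x) [^]\<^bsub>?GM Mod L\<^esub> k = L #>\<^bsub>?GM\<^esub> (x [^]\<^bsub>?GM\<^esub> k)"
      using N.FactGroup_int_pow[of x k] xM by simp
    ultimately show ?thesis using e int_pow_consistent[OF M xM] by auto
  qed
  moreover have LxQ: "L #>\<^bsub>?GM\<^esub> x \<in> carrier (?GM Mod L)"
    using xM by (auto simp: carrier_FactGroup)
  ultimately show "cyclic_group (?GM Mod L)"
    unfolding Q.cyclic_group using Q.int_pow_closed by blast
qed

text \<open>The identity \<open>x l x^-1 = (x l x^-1 l^-1) l\<close> makes every subgroup between
  \<open>derived G H\<close> and \<open>H\<close> normal in \<open>H\<close>.\<close>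

lemma conjugate_subset_of_commutators:
  assumes H: "subgroup H G" and L: "subgroup L G" "derived G H \<subseteq> L" "L \<subseteq> H" and x: "x \<in> H"
  shows "conjugate G x ` L \<subseteq> L"
proof
  fix y assume "y \<in> conjugate G x ` L"
  then obtain l where l: "l \<in> L" "y = x \<otimes> l \<otimes> inv x" by (auto simp: conjugate_def)
  have c: "x \<in> carrier G" "l \<in> carrier G" using x l H L subgroup.mem_carrier by fast+
  have "x \<otimes> l \<otimes> inv x \<otimes> inv l \<in> derived G H"
    unfolding derived_def using x l L(3) by (intro generate.incl) blast
  then have "x \<otimes> l \<otimes> inv x \<otimes> inv l \<otimes> l \<in> L" using l L by (blast intro: subgroup.m_closed)
  then show "y \<in> L" using c l by (simp add: m_assoc)
qed

lemma generate_insert_generate: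
  assumes "A \<subseteq> carrier G" "x \<in> carrier G"
  shows "generate G (insert x (generate G A)) = generate G (insert x A)"
proof
  show "generate G (insert x (generate G A)) \<subseteq> generate G (insert x A)"
    using assms mono_generate[of A "insert x A"]
    by (intro generate_subgroup_incl generate_is_subgroup) (auto intro: generate.incl)
  show "generate G (insert x A) \<subseteq> generate G (insert x (generate G A))"
    by (intro mono_generate) (auto intro: generate.incl)
qed

text \<open>The elements of \<open>S\<close> are adjoined to \<open>K\<close> one at a time, each
  giving a cyclic step. Finite generation passes down this chain and polycyclicity passes up; the
  latter is an implication because polycyclicity of \<open>K\<close> becomes available only once
  \<open>K\<close> is known to be finitely generated.\<close>

lemma abelian_extension_step:
  assumes nc: "\<And>t B. \<not> strictly_contracts G t B"
    and H: "subgroup H G" and K: "subgroup K G" "derived G H \<subseteq> K" "K \<subseteq> H"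
    and S: "finite S" "S \<subseteq> H"
    and T: "finite T" "T \<subseteq> carrier G" "generate G T = generate G (S \<union> K)"
  shows "(\<exists>A. finite A \<and> A \<subseteq> K \<and> generate G A = K) \<and>
    (polycyclic_group (G\<lparr>carrier := K\<rparr>) \<longrightarrow>
     polycyclic_group (G\<lparr>carrier := generate G (S \<union> K)\<rparr>))"
  using S T
proof (induction S arbitrary: T rule: finite_induct)
  case empty
  have "generate G K = K"
    using generate_subgroup_incl[of K K] K(1) by (auto intro: generate.incl)
  then show ?case using empty by (auto intro!: exI[of _ T] intro: generate.incl)
next
  case (insert x S)
  let ?L = "generate G (S \<union> K)"
  have carr: "S \<union> K \<subseteq> carrier G" "x \<in> carrier G" "S \<subseteq> H"
    using insert.prems subgroup.subset[OF H] K by auto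
  have L: "subgroup ?L G" by (rule generate_is_subgroup[OF carr(1)])
  have LH: "?L \<subseteq> H" using carr K by (intro generate_subgroup_incl[OF _ H]) auto
  have DL: "derived G H \<subseteq> ?L" using K(2) by (auto intro: generate.incl)
  have M: "generate G (insert x ?L) = generate G (insert x S \<union> K)"
    using generate_insert_generate[OF carr(1,2)] by simp
  have MH: "generate G (insert x ?L) \<subseteq> H"
    using insert.prems LH by (intro generate_subgroup_incl[OF _ H]) auto
  have conj: "conjugate G g ` ?L \<subseteq> ?L" if "g \<in> H" for g
    by (rule conjugate_subset_of_commutators[OF H L DL LH that])
  have "x \<in> H" "inv x \<in> H" using insert.prems subgroup.m_inv_closed[OF H] by auto
  \<comment> \<open>The kernel lemma turns the generating set \<open>T\<close> of the larger group
    into one of \<open>?L\<close>, which replaces \<open>T\<close> in the induction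
    hypothesis.\<close>
  then obtain A where A: "finite A" "A \<subseteq> ?L" "generate G A = ?L"
    using finitely_generated_cyclic_kernel[OF nc L carr(2) conj conj insert.prems(2) _ insert.prems(3)]
      insert.prems(4) M by metis
  have "A \<subseteq> carrier G" using A(2) subgroup.subset[OF L] by blast
  note IH = insert.IH[OF carr(3) A(1) this A(3)]
  note cyc = normal_cyclic_quotient[OF L carr(2) conj, OF subsetD[OF MH]]
  have "subgroup (generate G (insert x ?L)) G"
    using carr subgroup.subset[OF L] by (intro generate_is_subgroup) auto
  from polycyclic_group_extend[OF this cyc] IH show ?case unfolding M by blast
qed

text \<open>The induction runs up the solvable series with the finite generating set left arbitrary.
  \<open>abelian_extension_step\<close> supplies one for \<open>K\<close>, which opens the induction
  hypothesis.\<close>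

lemma solvable_imp_polycyclic:
  assumes nc: "\<And>t B. \<not> strictly_contracts G t B"
    and "solvable_seq G H" "finite T" "generate G T = H" "T \<subseteq> H"
  shows "polycyclic_group (G\<lparr>carrier := H\<rparr>)"
  using assms(2-)
proof (induction arbitrary: T)
  case unity
  show ?case by (rule polycyclic_group_trivial)
next
  case (extension K H)
  have K: "subgroup K G" by (rule solvable_imp_subgroup) fact
  have KH: "K \<subseteq> H" using subgroup.subset[OF normal_imp_subgroup[OF extension.hyps(2)]] by simp
  have "generate G (T \<union> K) = H"
    using generate_subgroup_incl[of "T \<union> K" H] mono_generate[of T "T \<union> K"] extension KH by auto
  \<comment> \<open>\<open>T\<close> serves both as the set adjoined to \<open>K\<close> and as the
    finite generating set of the result.\<close>
  then have step: "(\<exists>A. finite A \<and> A \<subseteq> K \<and> generate G A = K) \<and>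
    (polycyclic_group (G\<lparr>carrier := K\<rparr>) \<longrightarrow> polycyclic_group (G\<lparr>carrier := H\<rparr>))"
    using abelian_extension_step[OF nc extension.hyps(3) K
        derived_of_subgroup_minimal[OF extension.hyps(2-4)] KH, of T T]
      extension.prems subgroup.subset[OF extension.hyps(3)] by auto
  then show ?case using extension.IH by blast
qed

end


section \<open>Strict contractions generate ascending HNN extensions\<close>

primrec letter_eval :: "('a, 'm) monoid_scheme \<Rightarrow> 'a \<Rightarrow> 'a hnn_letter \<Rightarrow> 'a" where
  "letter_eval G t (Base b) = b"
| "letter_eval G t Stable = t"
| "letter_eval G t Stable_inv = inv\<^bsub>G\<^esub> t"

primrec word_eval :: "('a, 'm) monoid_scheme \<Rightarrow> 'a \<Rightarrow> 'a hnn_letter list \<Rightarrow> 'a" where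
  "word_eval G t [] = \<one>\<^bsub>G\<^esub>"
| "word_eval G t (l # w) = letter_eval G t l \<otimes>\<^bsub>G\<^esub> word_eval G t w"

locale strict_contraction = group G for G (structure) +
  fixes t B
  assumes contracts: "strictly_contracts G t B"
begin

text \<open>A plain \<open>monoid\<close> on \<open>B\<close>, the type that
  \<open>properly_ascending_hnn\<close> demands of the base; \<open>G\<close> itself may be an
  extended record.\<close>

definition base :: "'a monoid" where
  "base = \<lparr>carrier = B, monoid.mult = (\<otimes>), one = \<one>\<rparr>"

abbreviation "\<phi> \<equiv> conjugate G t"
abbreviation "words \<equiv> hnn_words base"
abbreviation "eqv \<equiv> hnn_eq base B \<phi>"
abbreviation "val \<equiv> word_eval G t"

lemma base_simps [simp]:
  "carrier base = B" "x \<otimes>\<^bsub>base\<^esub> y = x \<otimes> y" "\<one>\<^bsub>base\<^esub> = \<one>"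
  by (simp_all add: base_def)

lemma t_closed [simp]: "t \<in> carrier G"
  and B_subgroup: "subgroup B G"
  and phi_subset: "\<phi> ` B \<subseteq> B"
  and phi_not_onto: "\<phi> ` B \<noteq> B"
  using contracts by (auto simp: strictly_contracts_def)

sublocale B: subgroup B G by (rule B_subgroup)

lemma phi_closed [simp]: "b \<in> B \<Longrightarrow> \<phi> b \<in> B"
  using phi_subset by blast

lemma base_group: "group base"
  by (rule groupI) (auto simp: m_assoc intro!: bexI[of _ "inv _"])

lemma phi_mon: "\<phi> \<in> mon base base"
  using inj_on_subset[OF inj_on_conjugate[OF t_closed] B.subset]
  by (auto simp: mon_def hom_def conjugate_mult)

lemma hnn_hyps: "group base" "subgroup B base" "\<phi> \<in> hom (base\<lparr>carrier := B\<rparr>) base"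
  using base_group group.subgroup_self[OF base_group] phi_mon by (auto simp: mon_def hom_def)

lemma words_Nil [simp]: "[] \<in> words"
  and words_Cons [simp]: "l # w \<in> words \<longleftrightarrow> l \<in> Base ` B \<union> {Stable, Stable_inv} \<and> w \<in> words"
  and words_append [simp]: "u @ v \<in> words \<longleftrightarrow> u \<in> words \<and> v \<in> words"
  by (auto simp: hnn_words_def)

lemma words_replicate [simp]:
  "replicate n Stable \<in> words" "replicate n Stable_inv \<in> words"
  by (induction n) auto

lemma val_closed [simp]: "w \<in> words \<Longrightarrow> val w \<in> carrier G"
  by (induction w) auto

lemma val_append:
  "\<lbrakk>u \<in> words; v \<in> words\<rbrakk> \<Longrightarrow> val (u @ v) = val u \<otimes> val v"
  by (induction u) (auto simp: m_assoc)

lemma val_replicate: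
  "val (replicate n Stable) = t [^] n" "val (replicate n Stable_inv) = inv t [^] n"
  by (induction n) (simp_all add: group_commutes_pow)

lemma eqv_words: "eqv u v \<Longrightarrow> u \<in> words \<and> v \<in> words"
  using hnn_eq_words[OF hnn_hyps] .

lemma eqv_imp_val_eq: "eqv u v \<Longrightarrow> val u = val v"
proof (induction rule: hnn_eq.induct)
  case (append u u' v v')
  then show ?case using eqv_words by (simp add: val_append)
qed (auto simp: conjugate_def m_assoc)

lemma eqv_context:
  "\<lbrakk>eqv u v; p \<in> words; q \<in> words\<rbrakk> \<Longrightarrow> eqv (p @ u @ q) (p @ v @ q)"
  by (intro hnn_eq.append hnn_eq.refl)

section \<open>Normal forms of words\<close>

lemma eqv_push_Stable:
  assumes "b \<in> B" shows "eqv [Stable, Base b] [Base (\<phi> b), Stable]"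
proof -
  have "eqv ([Stable, Base b] @ [Stable_inv, Stable] @ []) ([Stable, Base b] @ [] @ [])"
    using assms by (intro eqv_context hnn_eq.stable_left_inv) auto
  moreover have "eqv ([] @ [Stable, Base b, Stable_inv] @ [Stable]) ([] @ [Base (\<phi> b)] @ [Stable])"
    using assms by (intro eqv_context hnn_eq.stable_conj) auto
  ultimately show ?thesis by simp (drule hnn_eq.sym, erule (1) hnn_eq.trans)
qed

text \<open>Inverse stable letters move left here and stable letters move right in
  \<open>eqv_push_Stable\<close>, each replacing \<open>b\<close> by \<open>\<phi> b\<close>. The
  opposite moves would require a preimage under \<open>\<phi>\<close>.\<close>

lemma eqv_push_Stable_inv:
  assumes "b \<in> B" shows "eqv [Base b, Stable_inv] [Stable_inv, Base (\<phi> b)]"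
proof -
  have "eqv ([] @ [Stable_inv, Stable] @ [Base b, Stable_inv]) ([] @ [] @ [Base b, Stable_inv])"
    using assms by (intro eqv_context hnn_eq.stable_left_inv) auto
  moreover have "eqv ([Stable_inv] @ [Stable, Base b, Stable_inv] @ []) ([Stable_inv] @ [Base (\<phi> b)] @ [])"
    using assms by (intro eqv_context hnn_eq.stable_conj) auto
  ultimately show ?thesis by simp (drule hnn_eq.sym, erule (1) hnn_eq.trans)
qed

lemma eqv_push_Stable_invs:
  "b \<in> B \<Longrightarrow> \<exists>b'\<in>B. eqv (Base b # replicate p Stable_inv) (replicate p Stable_inv @ [Base b'])"
proof (induction p arbitrary: b)
  case 0
  then show ?case by (intro bexI[of _ b]) (auto intro: hnn_eq.refl)
next
  case (Suc p)
  obtain b' where b': "b' \<in> B"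
    "eqv (Base (\<phi> b) # replicate p Stable_inv) (replicate p Stable_inv @ [Base b'])"
    using Suc.IH[of "\<phi> b"] Suc.prems by auto
  have "eqv ([] @ [Base b, Stable_inv] @ replicate p Stable_inv)
      ([] @ [Stable_inv, Base (\<phi> b)] @ replicate p Stable_inv)"
    using Suc.prems by (intro eqv_context eqv_push_Stable_inv) auto
  moreover have "eqv ([Stable_inv] @ (Base (\<phi> b) # replicate p Stable_inv) @ [])
      ([Stable_inv] @ (replicate p Stable_inv @ [Base b']) @ [])"
    using b' by (intro eqv_context) auto
  ultimately show ?case using b'(1) by (intro bexI[of _ b']) (simp, erule (1) hnn_eq.trans)
qed

text \<open>A new first letter is absorbed: a base letter passes the inverse stable letters and
  merges with \<open>b\<close>, \<open>Stable\<close> cancels or, for \<open>p = 0\<close>, passes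
  \<open>b\<close>, and \<open>Stable_inv\<close> lengthens the prefix. The form is not unique:
  \<open>t^-1 (\<phi> b) t\<close> and \<open>b\<close> agree.\<close>

lemma normal_form:
  assumes "w \<in> words"
  shows "\<exists>p b q. b \<in> B \<and> eqv w (replicate p Stable_inv @ Base b # replicate q Stable)"
  using assms
proof (induction w)
  case Nil
  have "eqv [] [Base \<one>]" using hnn_eq.sym[OF hnn_eq.base_one[of base B \<phi>]] by simp
  then show ?case by (intro exI[of _ 0] exI[of _ \<one>]) auto
next
  case (Cons l w)
  obtain p b q where b: "b \<in> B" and w: "eqv w (replicate p Stable_inv @ Base b # replicate q Stable)"
    using Cons by auto
  have lw: "eqv (l # w) (l # replicate p Stable_inv @ Base b # replicate q Stable)"
    using eqv_context[OF w, of "[l]" "[]"] Cons.prems by auto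
  consider (base) c where "c \<in> B" "l = Base c" | (cancel) p' where "l = Stable" "p = Suc p'"
    | (push) "l = Stable" "p = 0" | (inv) "l = Stable_inv"
    using Cons.prems by (cases p) auto
  then show ?case
  proof cases
    case base
    obtain c' where c': "c' \<in> B"
      "eqv (Base c # replicate p Stable_inv) (replicate p Stable_inv @ [Base c'])"
      using eqv_push_Stable_invs[OF base(1)] by blast
    have "eqv ([] @ (Base c # replicate p Stable_inv) @ (Base b # replicate q Stable))
      ([] @ (replicate p Stable_inv @ [Base c']) @ (Base b # replicate q Stable))"
      using b c' by (intro eqv_context) auto
    moreover have "eqv (replicate p Stable_inv @ [Base c', Base b] @ replicate q Stable)
      (replicate p Stable_inv @ [Base (c' \<otimes>\<^bsub>base\<^esub> b)] @ replicate q Stable)"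
      using b c' by (intro eqv_context hnn_eq.base_mult) auto
    ultimately have "eqv (Base c # replicate p Stable_inv @ Base b # replicate q Stable)
      (replicate p Stable_inv @ Base (c' \<otimes> b) # replicate q Stable)"
      by simp (erule (1) hnn_eq.trans)
    from hnn_eq.trans[OF lw[unfolded base(2)] this]
    have "eqv (l # w) (replicate p Stable_inv @ Base (c' \<otimes> b) # replicate q Stable)"
      unfolding base(2) .
    then show ?thesis using b c' by blast
  next
    case cancel
    have "eqv ([] @ [Stable, Stable_inv] @ (replicate p' Stable_inv @ Base b # replicate q Stable))
      ([] @ [] @ (replicate p' Stable_inv @ Base b # replicate q Stable))"
      using b by (intro eqv_context hnn_eq.stable_right_inv) auto
    then have "eqv (l # w) (replicate p' Stable_inv @ Base b # replicate q Stable)"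
      using lw cancel by simp (erule (1) hnn_eq.trans)
    then show ?thesis using b by blast
  next
    case push
    have "eqv ([] @ [Stable, Base b] @ replicate q Stable) ([] @ [Base (\<phi> b), Stable] @ replicate q Stable)"
      using b by (intro eqv_context eqv_push_Stable) auto
    then have "eqv (l # w) (replicate 0 Stable_inv @ Base (\<phi> b) # replicate (Suc q) Stable)"
      using lw push by simp (erule (1) hnn_eq.trans)
    then show ?thesis using b phi_closed by blast
  next
    case inv
    then have "eqv (l # w) (replicate (Suc p) Stable_inv @ Base b # replicate q Stable)"
      using lw by simp
    then show ?thesis using b by blast
  qed
qed

text \<open>If \<open>t\<close> had a positive power in \<open>B\<close>, then that power would normalise \<open>B\<close>, contradicting
  \<open>t\<^sup>n B t\<^sup>-\<^sup>n \<subseteq> t B t\<^sup>-\<^sup>1 \<subset> B\<close>.\<close>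

lemma pow_notin_base:
  assumes "n > 0" shows "t [^] (n::nat) \<notin> B"
proof
  assume tn: "t [^] n \<in> B"
  obtain m where n: "n = Suc m" using assms gr0_implies_Suc by blast
  have pow: "conjugate G (t [^] k) b \<in> B" if "b \<in> B" for k :: nat and b
  proof (induction k)
    case (Suc k)
    show ?case unfolding conjugate_pow_Suc[OF t_closed B.mem_carrier[OF that]]
      using Suc by (rule phi_closed)
  qed (use that in simp)
  have "b \<in> \<phi> ` B" if b: "b \<in> B" for b
  proof -
    define y where "y = conjugate G (inv (t [^] n)) b"
    have y: "y \<in> B" using b tn by (simp add: y_def conjugate_def)
    have "b = conjugate G (t [^] n) y" using b by (simp add: y_def conjugate_conjugate)
    also have "\<dots> = \<phi> (conjugate G (t [^] m) y)"
      unfolding n by (rule conjugate_pow_Suc[OF t_closed B.mem_carrier[OF y]])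
    finally show ?thesis using pow[OF y] by blast
  qed
  then show False using phi_subset phi_not_onto by blast
qed

text \<open>A normal form of value one yields \<open>b t^q = t^p\<close>. If \<open>p\<close> and
  \<open>q\<close> differed, a positive power of \<open>t\<close> would be \<open>b\<close> or its
  inverse; so they agree, \<open>b\<close> is one, and the stable letters cancel.\<close>

lemma val_kernel:
  assumes w: "w \<in> words" "val w = \<one>"
  shows "eqv w []"
proof -
  obtain p b q where b: "b \<in> B" and nf: "eqv w (replicate p Stable_inv @ Base b # replicate q Stable)"
    using normal_form[OF w(1)] by blast
  have "inv t [^] p \<otimes> (b \<otimes> t [^] q) = \<one>"
    using eqv_imp_val_eq[OF nf] w b by (simp add: val_append val_replicate)
  then have "t [^] p \<otimes> (inv (t [^] p) \<otimes> (b \<otimes> t [^] q)) = t [^] p \<otimes> \<one>"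
    by (simp only: nat_pow_inv[OF t_closed])
  then have bt: "b \<otimes> t [^] q = t [^] p" using b by simp
  have "p = q"
  proof (rule ccontr)
    assume "p \<noteq> q"
    then consider (less) n where "n > 0" "q = n + p" | (greater) n where "n > 0" "p = n + q"
      by (metis add.commute less_imp_add_positive linorder_neqE_nat)
    then show False
    proof cases
      case less
      have "b \<otimes> t [^] n \<otimes> t [^] p = \<one> \<otimes> t [^] p"
        using bt b by (simp add: less m_assoc nat_pow_mult)
      then have "b \<otimes> t [^] n = \<one>" using b by (subst (asm) right_cancel) auto
      then have "inv (t [^] n) = b" using b by (intro inv_equality) auto
      then have "t [^] n = inv b" by auto
      then show False using pow_notin_base[OF less(1)] B.m_inv_closed[OF b] by simp
    next
      case greater
      have "b \<otimes> t [^] q = t [^] n \<otimes> t [^] q" using bt by (simp add: greater nat_pow_mult)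
      then have "b = t [^] n" using b by (subst (asm) right_cancel) auto
      then show False using pow_notin_base[OF greater(1)] b by simp
    qed
  qed
  then have "b \<otimes> t [^] q = \<one> \<otimes> t [^] q" using bt by simp
  then have "b = \<one>" using b by (subst (asm) right_cancel) auto
  \<comment> \<open>Cancellation starts in the middle, where the two blocks meet.\<close>
  have cancel: "eqv (replicate n Stable_inv @ replicate n Stable) []" for n
  proof (induction n)
    case (Suc n)
    have "eqv (replicate n Stable_inv @ [Stable_inv, Stable] @ replicate n Stable)
      (replicate n Stable_inv @ [] @ replicate n Stable)"
      by (intro eqv_context hnn_eq.stable_left_inv) simp_all
    then have "eqv (replicate (Suc n) Stable_inv @ replicate (Suc n) Stable)
      (replicate n Stable_inv @ replicate n Stable)"
      by (simp add: replicate_app_Cons_same)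
    then show ?case using Suc by (rule hnn_eq.trans)
  qed (simp add: hnn_eq.refl)
  have "eqv (replicate p Stable_inv @ [Base \<one>\<^bsub>base\<^esub>] @ replicate p Stable)
    (replicate p Stable_inv @ [] @ replicate p Stable)"
    by (intro eqv_context hnn_eq.base_one) auto
  then have "eqv (replicate p Stable_inv @ Base \<one> # replicate p Stable) []"
    using cancel[of p] by simp (erule (1) hnn_eq.trans)
  then show ?thesis using nf unfolding \<open>b = \<one>\<close> \<open>p = q\<close> by (rule hnn_eq.trans[rotated])
qed

lemma val_eq_imp_eqv:
  assumes "u \<in> words" "v \<in> words" "val u = val v"
  shows "eqv u v"
proof -
  obtain v' where v': "v' \<in> words" "eqv (v' @ v) []"
    using hnn_left_inverse[OF base_group assms(2)] by blast
  obtain v'' where v'': "v'' \<in> words" "eqv (v'' @ v') []"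
    using hnn_left_inverse[OF base_group v'(1)] by blast
  \<comment> \<open>\<open>v''\<close> is a left inverse of the left inverse \<open>v'\<close> of
    \<open>v\<close>. Every word with the value of \<open>v\<close> is equivalent to it, in
    particular \<open>u\<close> and \<open>v\<close> themselves.\<close>
  have "eqv w v''" if w: "w \<in> words" "val w = val v" for w
  proof -
    have "val (v' @ w) = \<one>"
      using eqv_imp_val_eq[OF v'(2)] v'(1) w assms(2) by (simp add: val_append)
    then have "eqv (v' @ w) []" using v'(1) w by (intro val_kernel) auto
    then have "eqv (v'' @ (v' @ w) @ []) (v'' @ [] @ [])"
      using v''(1) by (intro eqv_context) auto
    then have 1: "eqv (v'' @ v' @ w) v''" by simp
    have "eqv ([] @ (v'' @ v') @ w) ([] @ [] @ w)"
      using v''(2) w by (intro eqv_context) auto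
    then have "eqv (v'' @ v' @ w) w" by simp
    from hnn_eq.trans[OF hnn_eq.sym[OF this] 1] show ?thesis .
  qed
  from hnn_eq.trans[OF this[OF assms(1,3)] hnn_eq.sym[OF this[OF assms(2) HOL.refl]]]
  show ?thesis .
qed

section \<open>Identification with the HNN extension\<close>

lemma val_image: "val ` words = generate G (insert t B)"
proof
  have "val w \<in> generate G (insert t B)" if "w \<in> words" for w
    using that
  proof (induction w)
    case (Cons l w)
    then have "letter_eval G t l \<in> generate G (insert t B)"
      by (auto intro: generate.incl generate.inv)
    then show ?case using Cons by (auto intro: generate.eng)
  qed (simp add: generate.one)
  then show "val ` words \<subseteq> generate G (insert t B)" by blast
  show "generate G (insert t B) \<subseteq> val ` words"
  proof
    fix e assume "e \<in> generate G (insert t B)"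
    then show "e \<in> val ` words"
    proof induction
      case one
      show ?case by (rule image_eqI[of _ _ "[]"]) auto
    next
      case (incl h)
      show ?case
        by (rule image_eqI[of _ _ "[if h = t then Stable else Base h]"]) (use incl in auto)
    next
      case (inv h)
      show ?case
        by (rule image_eqI[of _ _ "[if h = t then Stable_inv else Base (inv h)]"]) (use inv in auto)
    next
      case (eng h1 h2)
      then obtain u v where "u \<in> words" "h1 = val u" "v \<in> words" "h2 = val v" by blast
      then show ?case by (intro image_eqI[of _ _ "u @ v"]) (simp_all add: val_append)
    qed
  qed
qed

lemma properly_ascending_generate:
  "properly_ascending_hnn (G\<lparr>carrier := generate G (insert t B)\<rparr>)"
proof -
  let ?H = "generate G (insert t B)" and ?E = "hnn_extension base B \<phi>"
    and ?c = "\<lambda>w. hnn_rel base B \<phi> `` {w}"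
  \<comment> \<open>For \<open>h\<close> in \<open>?H\<close>, the words of value \<open>h\<close>
    form exactly one class of the HNN relation, so \<open>f\<close> inverts evaluation without a
    choice of representatives.\<close>
  define f where "f h = {w \<in> words. val w = h}" for h
  have c: "?c w = f (val w)" if "w \<in> words" for w
  proof -
    have "eqv w x \<longleftrightarrow> x \<in> words \<and> val x = val w" for x
      using eqv_words[of w x] eqv_imp_val_eq[of w x] val_eq_imp_eqv[OF that, of x] by metis
    then show ?thesis by (auto simp: f_def hnn_rel_def)
  qed
  have E: "carrier ?E = f ` ?H"
    unfolding val_image[symmetric] hnn_extension_def quotient_def by (auto simp: c)
  have "f (g \<otimes> h) = f g \<otimes>\<^bsub>?E\<^esub> f h" if gh: "g \<in> ?H" "h \<in> ?H" for g h
  proof -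
    obtain u v where uv: "u \<in> words" "g = val u" "v \<in> words" "h = val v"
      using gh unfolding val_image[symmetric] by blast
    then show ?thesis
      using hnn_mult_class[OF hnn_hyps uv(1,3)] by (simp add: c val_append)
  qed
  moreover have "inj_on f ?H"
  proof (rule inj_onI)
    fix g h assume "g \<in> ?H" "f g = f h"
    then obtain w where "w \<in> words" "g = val w" unfolding val_image[symmetric] by blast
    moreover from this have "w \<in> f h" using \<open>f g = f h\<close> by (auto simp: f_def)
    ultimately show "g = h" by (simp add: f_def)
  qed
  ultimately have "f \<in> iso (G\<lparr>carrier := ?H\<rparr>) ?E"
    by (auto simp: iso_def hom_def bij_betw_def E)
  then have "G\<lparr>carrier := ?H\<rparr> \<cong> hnn_extension base (carrier base) \<phi>"
    by (auto simp: is_iso_def)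
  moreover have "group (G\<lparr>carrier := ?H\<rparr>)"
    using B.subset by (intro subgroup_imp_group generate_is_subgroup) auto
  moreover have "\<phi> ` carrier base \<noteq> carrier base" using phi_not_onto by simp
  ultimately show ?thesis
    unfolding properly_ascending_hnn_def using base_group phi_mon by blast
qed

end


theorem theorem1:
  fixes \<Gamma> :: "('a, 'm) monoid_scheme"
  assumes "group \<Gamma>"
    and "finitely_generated_group \<Gamma>"
    and "solvable \<Gamma>"
    and "\<not> polycyclic_group \<Gamma>"
  shows "\<exists>H. subgroup H \<Gamma> \<and> properly_ascending_hnn (\<Gamma>\<lparr>carrier := H\<rparr>)"
proof -
  interpret group \<Gamma> by fact
  obtain T where T: "finite T" "T \<subseteq> carrier \<Gamma>" "generate \<Gamma> T = carrier \<Gamma>"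
    using assms(2) unfolding finitely_generated_group_def by blast
  have "\<exists>t B. strictly_contracts \<Gamma> t B"
  proof (rule ccontr)
    assume "\<nexists>t B. strictly_contracts \<Gamma> t B"
    then have "polycyclic_group (\<Gamma>\<lparr>carrier := carrier \<Gamma>\<rparr>)"
      using assms(3) T unfolding solvable_def by (intro solvable_imp_polycyclic[of _ T]) auto
    then show False using assms(4) by simp
  qed
  then obtain t B where "strictly_contracts \<Gamma> t B" by blast
  then interpret strict_contraction \<Gamma> t B by unfold_locales
  have "subgroup (generate \<Gamma> (insert t B)) \<Gamma>"
    using B.subset by (intro generate_is_subgroup) auto
  then show ?thesis using properly_ascending_generate by blast
qed

end
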